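(* Let $P$ be a poset that is weakly well-filtered and co-sober in its Scott topology. Then $P$ is a $\mathcal Q_{\sigma}$-unique poset; that is, for every poset $M$, if $(\mathcal Q(P),\supseteq)$ and $(\mathcal Q(M),\supseteq)$ are order isomorphic, then $P$ and $M$ are order isomorphic.
   Context: For a poset $P$ and $A\subseteq P$, ${\uparrow}A=\{x\in P: x\ge a \text{ for some } a\in A\}$ and ${\uparrow}x={\uparrow}\{x\}$; $A$ is an upper set if $A={\uparrow}A$. A subset $D\subseteq P$ is directed if every finite subset of $D$ (including the empty one) has an upper bound in $D$. A subset $U\subseteq P$ is Scott open if $U={\uparrow}U$ and for every directed $D\subseteq P$ whose supremum exists, $\sup D\in U$ implies $D\cap U\ne\emptyset$; the Scott open sets form the Scott topology. $\mathcal Q(P)$ denotes the set of all compact saturated subsets of $P$ with respect to the Scott topology (saturated means upper set; compact means every open cover has a finite subcover; the empty set is included), ordered by reverse inclusion. A topological space $X$ is weakly well-filtered if, whenever a nonempty open set $U$ contains the intersection $\bigcap_{i\in I}Q_i$ of a filtered family (i.e. directed under reverse inclusion) of compact saturated subsets of $X$, then $Q_i\subseteq U$ for some $i\in I$. A nonempty compact saturated subset $K$ of a space is $k$-irreducible if it cannot be written as the union of two proper compact saturated subsets (i.e. two compact saturated sets each properly contained in $K$). A space is co-sober if every $k$-irreducible compact saturated subset is the saturation of a point; for the Scott topology on $P$ this means it equals ${\uparrow}x$ for some $x\in P$. *)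

theory Defs
  imports "HOL-Analysis.Analysis"
begin

(* A poset is a carrier set P with a relation r such that partial_order_on P r;
   (x, y) : r reads x <= y.  The carrier may be empty. *)

definition up_closure :: "'a set \<Rightarrow> 'a rel \<Rightarrow> 'a set \<Rightarrow> 'a set" where
  "up_closure P r A = {x \<in> P. \<exists>a\<in>A. (a, x) \<in> r}"

definition upper_set :: "'a set \<Rightarrow> 'a rel \<Rightarrow> 'a set \<Rightarrow> bool" where
  "upper_set P r A \<longleftrightarrow> A \<subseteq> P \<and> A = up_closure P r A"

(* The finite set F may be empty, so a directed set is nonempty. *)
definition directed_set :: "'a rel \<Rightarrow> 'a set \<Rightarrow> bool" where
  "directed_set r D \<longleftrightarrow> (\<forall>F. finite F \<and> F \<subseteq> D \<longrightarrow> (\<exists>u\<in>D. \<forall>x\<in>F. (x, u) \<in> r))"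

definition is_supremum :: "'a set \<Rightarrow> 'a rel \<Rightarrow> 'a set \<Rightarrow> 'a \<Rightarrow> bool" where
  "is_supremum P r D s \<longleftrightarrow>
     s \<in> P \<and> (\<forall>d\<in>D. (d, s) \<in> r) \<and> (\<forall>u\<in>P. (\<forall>d\<in>D. (d, u) \<in> r) \<longrightarrow> (s, u) \<in> r)"

definition scott_open :: "'a set \<Rightarrow> 'a rel \<Rightarrow> 'a set \<Rightarrow> bool" where
  "scott_open P r U \<longleftrightarrow>
     upper_set P r U \<and>
     (\<forall>D s. D \<subseteq> P \<and> directed_set r D \<and> is_supremum P r D s \<and> s \<in> U \<longrightarrow> D \<inter> U \<noteq> {})"

definition scott_topology :: "'a set \<Rightarrow> 'a rel \<Rightarrow> 'a topology" where
  "scott_topology P r = topology (scott_open P r)"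

definition rev_incl :: "'a set set \<Rightarrow> 'a set rel" where
  "rev_incl \<A> = {(A, B). A \<in> \<A> \<and> B \<in> \<A> \<and> A \<supseteq> B}"

definition compact_upper_sets :: "'a set \<Rightarrow> 'a rel \<Rightarrow> 'a set set" where
  "compact_upper_sets P r = {K. compactin (scott_topology P r) K \<and> upper_set P r K}"

definition order_isomorphic :: "'a set \<Rightarrow> 'a rel \<Rightarrow> 'b set \<Rightarrow> 'b rel \<Rightarrow> bool" where
  "order_isomorphic P r M s \<longleftrightarrow>
     (\<exists>f. bij_betw f P M \<and> (\<forall>x\<in>P. \<forall>y\<in>P. (x, y) \<in> r \<longleftrightarrow> (f x, f y) \<in> s))"

(* HOL cannot quantify over types inside a definition, so the type of the elements of
   M is a parameter; a theorem in which 'b is free covers every poset M. *)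
definition Q_sigma_unique :: "'b itself \<Rightarrow> 'a set \<Rightarrow> 'a rel \<Rightarrow> bool" where
  "Q_sigma_unique (_ :: 'b itself) P r \<longleftrightarrow>
     (\<forall>(M :: 'b set) s. partial_order_on M s \<longrightarrow>
        order_isomorphic
          (compact_upper_sets P r) (rev_incl (compact_upper_sets P r))
          (compact_upper_sets M s) (rev_incl (compact_upper_sets M s)) \<longrightarrow>
        order_isomorphic P r M s)"

(* In a general space, saturation is the intersection of all open neighbourhoods, i.e.
   the up-closure for the specialization preorder; for a Scott topology it is
   up_closure, see saturation_scott_topology below. *)
definition saturation :: "'a topology \<Rightarrow> 'a set \<Rightarrow> 'a set" where
  "saturation X A = topspace X \<inter> \<Inter>{U. openin X U \<and> A \<subseteq> U}"

definition compact_saturated :: "'a topology \<Rightarrow> 'a set \<Rightarrow> bool" where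
  "compact_saturated X K \<longleftrightarrow> compactin X K \<and> saturation X K = K"

(* Directedness for rev_incl already makes the family \<Q> nonempty. *)
definition weakly_well_filtered :: "'a topology \<Rightarrow> bool" where
  "weakly_well_filtered X \<longleftrightarrow>
     (\<forall>U \<Q>. openin X U \<and> U \<noteq> {} \<and> (\<forall>Q\<in>\<Q>. compact_saturated X Q) \<and>
             directed_set (rev_incl \<Q>) \<Q> \<and> \<Inter>\<Q> \<subseteq> U \<longrightarrow>
             (\<exists>Q\<in>\<Q>. Q \<subseteq> U))"

definition k_irreducible :: "'a topology \<Rightarrow> 'a set \<Rightarrow> bool" where
  "k_irreducible X K \<longleftrightarrow>
     K \<noteq> {} \<and> compact_saturated X K \<and>
     \<not> (\<exists>A B. compact_saturated X A \<and> compact_saturated X B \<and>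
              A \<subset> K \<and> B \<subset> K \<and> K = A \<union> B)"

definition co_sober :: "'a topology \<Rightarrow> bool" where
  "co_sober X \<longleftrightarrow> (\<forall>K. k_irreducible X K \<longrightarrow> (\<exists>x\<in>topspace X. K = saturation X {x}))"


lemma upper_setD: "upper_set P r U \<Longrightarrow> a \<in> U \<Longrightarrow> (a, x) \<in> r \<Longrightarrow> x \<in> P \<Longrightarrow> x \<in> U"
  unfolding upper_set_def up_closure_def by blast

lemma upper_setI:
  assumes "partial_order_on P r" "A \<subseteq> P" "\<And>a x. a \<in> A \<Longrightarrow> x \<in> P \<Longrightarrow> (a, x) \<in> r \<Longrightarrow> x \<in> A"
  shows "upper_set P r A"
  using assms partial_order_onD(1)[OF assms(1)]
  unfolding upper_set_def up_closure_def refl_on_def by blast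

lemma istopology_scott_open:
  assumes po: "partial_order_on P r"
  shows "istopology (scott_open P r)"
  unfolding istopology_def
proof (intro conjI allI impI)
  fix U V assume U: "scott_open P r U" and V: "scott_open P r V"
  have uU: "upper_set P r U" and uV: "upper_set P r V"
    using U V by (auto simp: scott_open_def)
  have sub: "U \<subseteq> P" "V \<subseteq> P" using uU uV by (auto simp: upper_set_def)
  show "scott_open P r (U \<inter> V)"
    unfolding scott_open_def
  proof (intro conjI allI impI)
    show "upper_set P r (U \<inter> V)"
      using sub uU uV by (intro upper_setI[OF po]) (auto dest: upper_setD)
  next
    fix D s assume D: "D \<subseteq> P \<and> directed_set r D \<and> is_supremum P r D s \<and> s \<in> U \<inter> V"
    obtain d where d: "d \<in> D" "d \<in> U" using D U unfolding scott_open_def by blast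
    obtain e where e: "e \<in> D" "e \<in> V" using D V unfolding scott_open_def by blast
    have "\<exists>u\<in>D. \<forall>x\<in>{d, e}. (x, u) \<in> r"
      using D d e unfolding directed_set_def by (metis finite.emptyI finite.insertI empty_subsetI insert_subset)
    then obtain u where u: "u \<in> D" "(d, u) \<in> r" "(e, u) \<in> r" by blast
    then have "u \<in> U \<inter> V" using D d e uU uV by (blast dest: upper_setD)
    then show "D \<inter> (U \<inter> V) \<noteq> {}" using u by blast
  qed
next
  fix \<K> assume K: "\<forall>K\<in>\<K>. scott_open P r K"
  show "scott_open P r (\<Union>\<K>)"
    unfolding scott_open_def
  proof (intro conjI allI impI)
    show "upper_set P r (\<Union>\<K>)"
    proof (rule upper_setI[OF po])
      show "\<Union>\<K> \<subseteq> P" using K by (auto simp: scott_open_def upper_set_def)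
    next
      fix a x assume "a \<in> \<Union>\<K>" "x \<in> P" "(a, x) \<in> r"
      moreover from this obtain U where "U \<in> \<K>" "a \<in> U" by blast
      moreover have "upper_set P r U" using K \<open>U \<in> \<K>\<close> by (simp add: scott_open_def)
      ultimately show "x \<in> \<Union>\<K>" using upper_setD by (metis UnionI)
    qed
  next
    fix D s assume "D \<subseteq> P \<and> directed_set r D \<and> is_supremum P r D s \<and> s \<in> \<Union>\<K>"
    moreover from this obtain U where "U \<in> \<K>" "s \<in> U" by blast
    moreover have "scott_open P r U" using K \<open>U \<in> \<K>\<close> by simp
    ultimately have "D \<inter> U \<noteq> {}" unfolding scott_open_def by metis
    then show "D \<inter> \<Union>\<K> \<noteq> {}" using \<open>U \<in> \<K>\<close> by blast
  qed
qed

lemma openin_scott_topology: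
  "partial_order_on P r \<Longrightarrow> openin (scott_topology P r) U \<longleftrightarrow> scott_open P r U"
  unfolding scott_topology_def by (simp add: istopology_scott_open topology_inverse')

lemma topspace_scott_topology:
  assumes po: "partial_order_on P r"
  shows "topspace (scott_topology P r) = P"
proof
  show "topspace (scott_topology P r) \<subseteq> P"
    unfolding topspace_def by (auto simp: openin_scott_topology[OF po] scott_open_def upper_set_def)
  have "scott_open P r P"
    unfolding scott_open_def
  proof (intro conjI allI impI)
    show "upper_set P r P" by (intro upper_setI[OF po]) auto
  next
    fix D s assume D: "D \<subseteq> P \<and> directed_set r D \<and> is_supremum P r D s \<and> s \<in> P"
    then have "\<exists>u\<in>D. \<forall>x\<in>{}. (x, u) \<in> r" unfolding directed_set_def by blast
    then show "D \<inter> P \<noteq> {}" using D by blast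
  qed
  then show "P \<subseteq> topspace (scott_topology P r)"
    by (simp add: openin_scott_topology[OF po] openin_subset)
qed

lemma saturation_scott_topology:
  assumes po: "partial_order_on P r" and A: "A \<subseteq> P"
  shows "saturation (scott_topology P r) A = up_closure P r A"
proof
  show "up_closure P r A \<subseteq> saturation (scott_topology P r) A"
  proof
    fix x assume "x \<in> up_closure P r A"
    then obtain a where a: "x \<in> P" "a \<in> A" "(a, x) \<in> r" by (auto simp: up_closure_def)
    have "x \<in> U" if "scott_open P r U" "A \<subseteq> U" for U
      using that a upper_setD[of P r U a x] by (auto simp: scott_open_def)
    then show "x \<in> saturation (scott_topology P r) A"
      using a by (simp add: saturation_def topspace_scott_topology[OF po] openin_scott_topology[OF po])
  qed
  show "saturation (scott_topology P r) A \<subseteq> up_closure P r A"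
  proof
    fix y assume y: "y \<in> saturation (scott_topology P r) A"
    then have yP: "y \<in> P" by (simp add: saturation_def topspace_scott_topology[OF po])
    let ?U = "{x \<in> P. (x, y) \<notin> r}"
    show "y \<in> up_closure P r A"
    proof (rule ccontr)
      assume n: "y \<notin> up_closure P r A"
      have "scott_open P r ?U"
        unfolding scott_open_def
      proof (intro conjI allI impI)
        show "upper_set P r ?U"
          using partial_order_onD(2)[OF po] by (intro upper_setI[OF po]) (auto dest: transD)
      next
        fix D s assume "D \<subseteq> P \<and> directed_set r D \<and> is_supremum P r D s \<and> s \<in> ?U"
        then show "D \<inter> ?U \<noteq> {}" using yP unfolding is_supremum_def by blast
      qed
      moreover have "A \<subseteq> ?U" using n A yP by (auto simp: up_closure_def)
      ultimately have "y \<in> ?U"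
        using y unfolding saturation_def openin_scott_topology[OF po] by blast
      then show False
        using partial_order_onD(1)[OF po] yP by (auto simp: refl_on_def)
    qed
  qed
qed

lemma compact_saturated_scott_topology:
  assumes po: "partial_order_on P r"
  shows "compact_saturated (scott_topology P r) K \<longleftrightarrow> K \<in> compact_upper_sets P r"
proof -
  have "K \<subseteq> P" if "compactin (scott_topology P r) K"
    using compactin_subset_topspace[OF that] by (simp add: topspace_scott_topology[OF po])
  then show ?thesis
    by (auto simp: compact_saturated_def compact_upper_sets_def upper_set_def
        saturation_scott_topology[OF po])
qed

end

theory Submission
  imports Defs
begin

text \<open>
  A poset can be read off from the order of its compact upper sets as soon as it is known which
  elements of that order are the principal filters. Write \<open>Q(P)\<close> for the compact upper sets.
  A principal filter is always \<open>k\<close>-irreducible, and \<open>k\<close>-irreducibility is expressed by inclusion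
  alone, because binary unions are least upper bounds for inclusion and the empty set is the least
  element. Hence an isomorphism \<open>\<phi>\<close> from \<open>Q(M)\<close> to \<open>Q(P)\<close> sends the filter of \<open>y\<close> to a
  \<open>k\<close>-irreducible set, which is the filter of some \<open>g y\<close> when \<open>P\<close> is co-sober. The map \<open>g\<close> is an
  order embedding of \<open>M\<close> into \<open>P\<close> (\<open>k_irreducible_principal\<close>, \<open>k_irreducible_iso\<close>). The issue is
  its surjectivity, since a priori \<open>M\<close> may have \<open>k\<close>-irreducible sets that are not principal.

  The key observation is that \<open>g\<close> preserves all existing directed suprema: the filter of a supremum
  is the largest compact upper set inside the filters of the members, a description that \<open>\<phi>\<close>
  respects. So \<open>g\<close> is Scott continuous (\<open>continuous_map_scott_topology\<close>) and maps compact sets to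
  compact sets, which generate compact upper sets (\<open>up_closure_in_compact_upper_sets\<close>). Given \<open>x\<close> in \<open>P\<close>,
  let \<open>K\<close> be the set in \<open>Q(M)\<close> that \<open>\<phi>\<close> sends to the filter of \<open>x\<close>. Then \<open>\<phi> K\<close> lies in every
  member of \<open>Q(P)\<close> that contains \<open>g ` K\<close>, and the upper set generated by \<open>g ` K\<close> is such a member.
  Therefore \<open>x\<close> lies above \<open>g y\<close> for some \<open>y \<in> K\<close>, while \<open>y \<in> K\<close> puts \<open>g y\<close> above \<open>x\<close>;
  thus \<open>x = g y\<close>.
\<close>

lemma order_isomorphic_sym:
  assumes "order_isomorphic P r M s"
  shows "order_isomorphic M s P r"
proof -
  obtain f where f: "bij_betw f P M" "\<forall>x\<in>P. \<forall>y\<in>P. (x, y) \<in> r \<longleftrightarrow> (f x, f y) \<in> s"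
    using assms by (auto simp: order_isomorphic_def)
  let ?g = "inv_into P f"
  have g: "bij_betw ?g M P" using f(1) by (rule bij_betw_inv_into)
  have "(x, y) \<in> s \<longleftrightarrow> (?g x, ?g y) \<in> r" if "x \<in> M" "y \<in> M" for x y
    using that f(2) bij_betwE[OF g] bij_betw_inv_into_right[OF f(1)] by simp
  then show ?thesis using g by (auto simp: order_isomorphic_def)
qed

lemma order_isomorphic_rev_incl_iff:
  "order_isomorphic \<A> (rev_incl \<A>) \<B> (rev_incl \<B>) \<longleftrightarrow>
     (\<exists>\<phi>. bij_betw \<phi> \<A> \<B> \<and> (\<forall>A\<in>\<A>. \<forall>B\<in>\<A>. A \<subseteq> B \<longleftrightarrow> \<phi> A \<subseteq> \<phi> B))"
proof -
  have "(\<forall>A\<in>\<A>. \<forall>B\<in>\<A>. (A, B) \<in> rev_incl \<A> \<longleftrightarrow> (\<phi> A, \<phi> B) \<in> rev_incl \<B>) \<longleftrightarrow>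
        (\<forall>A\<in>\<A>. \<forall>B\<in>\<A>. A \<subseteq> B \<longleftrightarrow> \<phi> A \<subseteq> \<phi> B)" if "bij_betw \<phi> \<A> \<B>" for \<phi>
    using bij_betwE[OF that] by (auto simp: rev_incl_def)
  then show ?thesis unfolding order_isomorphic_def by (intro ex_cong1 conj_cong refl)
qed

lemma up_closure_subset: "up_closure P r A \<subseteq> P"
  by (auto simp: up_closure_def)

lemma upper_set_up_closure:
  assumes po: "partial_order_on P r"
  shows "upper_set P r (up_closure P r A)"
  using partial_order_onD(2)[OF po]
  by (intro upper_setI[OF po]) (auto simp: up_closure_def dest: transD)

lemma subset_up_closure:
  assumes "partial_order_on P r" "A \<subseteq> P"
  shows "A \<subseteq> up_closure P r A"
  using assms(2) partial_order_onD(1)[OF assms(1)] by (auto simp: up_closure_def refl_on_def)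

text \<open>Open sets are upper sets, so a set and the upper set it generates have the same open covers.\<close>

lemma up_closure_in_compact_upper_sets:
  assumes po: "partial_order_on P r" and C: "compactin (scott_topology P r) C"
  shows "up_closure P r C \<in> compact_upper_sets P r"
proof -
  note top = topspace_scott_topology[OF po]
  have CP: "C \<subseteq> P" using compactin_subset_topspace[OF C] top by simp
  have "compactin (scott_topology P r) (up_closure P r C)"
    unfolding compactin_def
  proof (intro conjI allI impI)
    show "up_closure P r C \<subseteq> topspace (scott_topology P r)" by (simp add: top up_closure_subset)
  next
    fix \<U> assume U: "Ball \<U> (openin (scott_topology P r)) \<and> up_closure P r C \<subseteq> \<Union>\<U>"
    then have "C \<subseteq> \<Union>\<U>" using subset_up_closure[OF po CP] by blast
    then obtain \<F> where F: "finite \<F>" "\<F> \<subseteq> \<U>" "C \<subseteq> \<Union>\<F>"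
      using C U unfolding compactin_def by meson
    have "upper_set P r V" if "V \<in> \<F>" for V
      using that U F openin_scott_topology[OF po] by (auto simp: scott_open_def)
    then have "x \<in> \<Union>\<F>" if "a \<in> C" "(a, x) \<in> r" "x \<in> P" for a x
      using that F(3) upper_setD by (metis UnionE UnionI subsetD)
    then have "up_closure P r C \<subseteq> \<Union>\<F>" by (auto simp: up_closure_def)
    then show "\<exists>\<F>. finite \<F> \<and> \<F> \<subseteq> \<U> \<and> up_closure P r C \<subseteq> \<Union>\<F>" using F by blast
  qed
  then show ?thesis by (simp add: compact_upper_sets_def upper_set_up_closure[OF po])
qed

lemma principal_in_compact_upper_sets:
  assumes "partial_order_on P r" "x \<in> P"
  shows "up_closure P r {x} \<in> compact_upper_sets P r"
  using assms by (intro up_closure_in_compact_upper_sets) (auto simp: topspace_scott_topology)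

lemma mem_principal: "y \<in> up_closure P r {x} \<longleftrightarrow> y \<in> P \<and> (x, y) \<in> r"
  by (simp add: up_closure_def)

lemma principal_subset_iff:
  assumes po: "partial_order_on P r" and x: "x \<in> P" and A: "upper_set P r A"
  shows "up_closure P r {x} \<subseteq> A \<longleftrightarrow> x \<in> A"
  using subset_up_closure[OF po, of "{x}"] x A by (auto simp: mem_principal dest: upper_setD)

lemma compact_upper_sets_Un:
  assumes po: "partial_order_on P r"
    and "A \<in> compact_upper_sets P r" "B \<in> compact_upper_sets P r"
  shows "A \<union> B \<in> compact_upper_sets P r"
proof -
  have A: "upper_set P r A" and B: "upper_set P r B"
    using assms(2,3) by (auto simp: compact_upper_sets_def)
  have "A \<union> B \<subseteq> P" using A B by (simp add: upper_set_def)
  then have "upper_set P r (A \<union> B)"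
    by (rule upper_setI[OF po]) (use upper_setD[OF A] upper_setD[OF B] in blast)
  then show ?thesis using assms(2,3) by (auto simp: compact_upper_sets_def intro: compactin_Un)
qed

lemma empty_in_compact_upper_sets: "{} \<in> compact_upper_sets P r"
  by (simp add: compact_upper_sets_def upper_set_def up_closure_def)

text \<open>Whichever of two upper sets covering a principal filter contains its generator contains the
  whole filter.\<close>

lemma k_irreducible_principal:
  assumes po: "partial_order_on P r" and x: "x \<in> P"
  shows "k_irreducible (scott_topology P r) (up_closure P r {x})"
proof -
  have mem: "x \<in> up_closure P r {x}" using subset_up_closure[OF po, of "{x}"] x by blast
  have "x \<notin> A" if "A \<in> compact_upper_sets P r" "A \<subset> up_closure P r {x}" for A
    using that principal_subset_iff[OF po x, of A] by (auto simp: compact_upper_sets_def)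
  then show ?thesis
    using mem principal_in_compact_upper_sets[OF po x]
    unfolding k_irreducible_def compact_saturated_scott_topology[OF po] by blast
qed

text \<open>An isomorphism preserves \<open>k\<close>-irreducibility because it preserves the least element and binary
  unions, these being the binary suprema for inclusion.\<close>

lemma k_irreducible_iso:
  assumes poM: "partial_order_on M s" and poP: "partial_order_on P r"
    and bij: "bij_betw \<phi> (compact_upper_sets M s) (compact_upper_sets P r)"
    and iso: "\<And>A B. A \<in> compact_upper_sets M s \<Longrightarrow> B \<in> compact_upper_sets M s \<Longrightarrow>
                A \<subseteq> B \<longleftrightarrow> \<phi> A \<subseteq> \<phi> B"
    and K: "k_irreducible (scott_topology M s) K"
  shows "k_irreducible (scott_topology P r) (\<phi> K)"
proof -
  let ?QM = "compact_upper_sets M s" and ?QP = "compact_upper_sets P r"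
  have KQ: "K \<in> ?QM" and Kne: "K \<noteq> {}"
    and irr: "\<And>A B. A \<in> ?QM \<Longrightarrow> B \<in> ?QM \<Longrightarrow> A \<subset> K \<Longrightarrow> B \<subset> K \<Longrightarrow> K \<noteq> A \<union> B"
    using K unfolding k_irreducible_def compact_saturated_scott_topology[OF poM] by blast+
  have ne: "\<phi> K \<noteq> {}"
    using iso[OF KQ empty_in_compact_upper_sets] Kne by auto
  have False if A: "A \<in> ?QP" "A \<subset> \<phi> K" and B: "B \<in> ?QP" "B \<subset> \<phi> K" and AB: "\<phi> K = A \<union> B" for A B
  proof -
    obtain A' B' where A': "A' \<in> ?QM" "A = \<phi> A'" and B': "B' \<in> ?QM" "B = \<phi> B'"
      using A(1) B(1) bij by (metis bij_betw_imp_surj_on imageE)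
    have U: "A' \<union> B' \<in> ?QM" using compact_upper_sets_Un[OF poM A'(1) B'(1)] .
    have sub: "A' \<subset> K" "B' \<subset> K"
      using A(2) B(2) A' B' iso[OF A'(1) KQ] iso[OF B'(1) KQ] by auto
    have "\<phi> K \<subseteq> \<phi> (A' \<union> B')"
      using AB A' B' iso[OF A'(1) U] iso[OF B'(1) U] by auto
    then have "K = A' \<union> B'" using iso[OF KQ U] sub by auto
    then show False using irr A' B' sub by blast
  qed
  then show ?thesis
    using ne KQ bij_betwE[OF bij]
    unfolding k_irreducible_def compact_saturated_scott_topology[OF poP] by blast
qed

lemma continuous_map_scott_topology:
  assumes poM: "partial_order_on M s" and poP: "partial_order_on P r"
    and g: "g ` M \<subseteq> P"
    and mono: "\<And>x y. x \<in> M \<Longrightarrow> y \<in> M \<Longrightarrow> (x, y) \<in> s \<Longrightarrow> (g x, g y) \<in> r"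
    and sup: "\<And>D t. D \<subseteq> M \<Longrightarrow> directed_set s D \<Longrightarrow> is_supremum M s D t \<Longrightarrow>
                is_supremum P r (g ` D) (g t)"
  shows "continuous_map (scott_topology M s) (scott_topology P r) g"
  unfolding continuous_map topspace_scott_topology[OF poM] topspace_scott_topology[OF poP]
    openin_scott_topology[OF poM] openin_scott_topology[OF poP]
proof (intro conjI allI impI)
  show "g ` M \<subseteq> P" by (rule g)
next
  fix U assume U: "scott_open P r U"
  then have up: "upper_set P r U" by (simp add: scott_open_def)
  show "scott_open M s {x \<in> M. g x \<in> U}"
    unfolding scott_open_def
  proof (intro conjI allI impI)
    show "upper_set M s {x \<in> M. g x \<in> U}"
      using g mono up by (intro upper_setI[OF poM]) (auto dest: upper_setD)
  next
    fix D t assume D: "D \<subseteq> M \<and> directed_set s D \<and> is_supremum M s D t \<and> t \<in> {x \<in> M. g x \<in> U}"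
    have "directed_set r (g ` D)"
      unfolding directed_set_def
    proof (intro allI impI)
      fix F assume "finite F \<and> F \<subseteq> g ` D"
      then obtain E where E: "finite E" "E \<subseteq> D" "F = g ` E"
        by (meson finite_subset_image)
      then obtain u where "u \<in> D" "\<forall>x\<in>E. (x, u) \<in> s"
        using D unfolding directed_set_def by meson
      then show "\<exists>u\<in>g ` D. \<forall>x\<in>F. (x, u) \<in> r"
        using E D mono by blast
    qed
    moreover have "is_supremum P r (g ` D) (g t)" using D sup by blast
    moreover have "g ` D \<subseteq> P" using D g by blast
    ultimately have "g ` D \<inter> U \<noteq> {}" using U D unfolding scott_open_def by blast
    then show "D \<inter> {x \<in> M. g x \<in> U} \<noteq> {}" using D by blast
  qed
qed

text \<open>The \<open>k\<close>-irreducible sets of \<open>M\<close> turn out to be principal as well: such a set \<open>K\<close> corresponds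
  to the filter of some \<open>x\<close> in \<open>P\<close>, and compactness of the image of \<open>K\<close> forces \<open>x\<close> itself to be in that image, so
  \<open>K\<close> must have a least element.\<close>

lemma order_isomorphic_of_co_sober:
  assumes poM: "partial_order_on M s" and poP: "partial_order_on P r"
    and cs: "co_sober (scott_topology P r)"
    and bij: "bij_betw \<phi> (compact_upper_sets M s) (compact_upper_sets P r)"
    and iso: "\<And>A B. A \<in> compact_upper_sets M s \<Longrightarrow> B \<in> compact_upper_sets M s \<Longrightarrow>
                A \<subseteq> B \<longleftrightarrow> \<phi> A \<subseteq> \<phi> B"
  shows "order_isomorphic M s P r"
proof -
  let ?QM = "compact_upper_sets M s" and ?QP = "compact_upper_sets P r"
  let ?uM = "\<lambda>y. up_closure M s {y}" and ?uP = "\<lambda>x. up_closure P r {x}"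
  have up: "upper_set P r A" if "A \<in> ?QP" for A using that by (simp add: compact_upper_sets_def)
  have upM: "upper_set M s A" if "A \<in> ?QM" for A using that by (simp add: compact_upper_sets_def)
  have QM: "?uM y \<in> ?QM" if "y \<in> M" for y by (rule principal_in_compact_upper_sets[OF poM that])
  have QP: "?uP x \<in> ?QP" if "x \<in> P" for x by (rule principal_in_compact_upper_sets[OF poP that])
  have "\<exists>x\<in>P. \<phi> (?uM y) = ?uP x" if y: "y \<in> M" for y
    using k_irreducible_iso[OF poM poP bij iso k_irreducible_principal[OF poM y]] cs
      saturation_scott_topology[OF poP]
    unfolding co_sober_def topspace_scott_topology[OF poP] by fastforce
  then obtain g where gP: "\<And>y. y \<in> M \<Longrightarrow> g y \<in> P"
    and g: "\<And>y. y \<in> M \<Longrightarrow> \<phi> (?uM y) = ?uP (g y)" by metis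
  \<comment> \<open>Membership in an upper set is inclusion of the principal filter, which \<open>\<phi>\<close> respects.\<close>
  have mem: "y \<in> K \<longleftrightarrow> g y \<in> \<phi> K" if "y \<in> M" "K \<in> ?QM" for y K
    using that iso[OF QM that(2)] g gP bij_betwE[OF bij]
      principal_subset_iff[OF poM that(1) upM] principal_subset_iff[OF poP gP up] by metis
  have emb: "(x, y) \<in> s \<longleftrightarrow> (g x, g y) \<in> r" if "x \<in> M" "y \<in> M" for x y
    using mem[OF that(2) QM[OF that(1)]] that gP g by (simp add: mem_principal)
  have cont: "continuous_map (scott_topology M s) (scott_topology P r) g"
  proof (rule continuous_map_scott_topology[OF poM poP])
    show "g ` M \<subseteq> P" using gP by blast
  next
    fix D t assume D: "D \<subseteq> M" and t: "is_supremum M s D t"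
    have tM: "t \<in> M" using t by (simp add: is_supremum_def)
    have "(g t, u) \<in> r" if u: "u \<in> P" "\<forall>d\<in>g ` D. (d, u) \<in> r" for u
    proof -
      \<comment> \<open>An upper bound \<open>u\<close> of the image need not be in the range of \<open>g\<close>, so the comparison with
        \<open>t\<close> is made through the compact upper set of \<open>M\<close> that corresponds to its filter.\<close>
      obtain L where L: "L \<in> ?QM" "\<phi> L = ?uP u"
        using QP[OF u(1)] bij by (metis bij_betw_imp_surj_on imageE)
      have "L \<subseteq> ?uM d" if "d \<in> D" for d
      proof -
        have dM: "d \<in> M" using that D by blast
        have "u \<in> ?uP (g d)" using u that by (simp add: mem_principal)
        then have "\<phi> L \<subseteq> \<phi> (?uM d)"
          using principal_subset_iff[OF poP u(1) up[OF QP[OF gP[OF dM]]]] L(2) g[OF dM] by simp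
        then show ?thesis using iso[OF L(1) QM[OF dM]] by simp
      qed
      then have "L \<subseteq> ?uM t"
        using t upM[OF L(1)] by (fastforce simp: is_supremum_def mem_principal upper_set_def)
      then have "?uP u \<subseteq> ?uP (g t)" using iso[OF L(1) QM[OF tM]] L(2) g[OF tM] by simp
      then show ?thesis
        using principal_subset_iff[OF poP u(1) up[OF QP[OF gP[OF tM]]]] by (simp add: mem_principal)
    qed
    moreover have "(g d, g t) \<in> r" if "d \<in> D" for d
      using that t D tM emb by (auto simp: is_supremum_def)
    ultimately show "is_supremum P r (g ` D) (g t)"
      using gP[OF tM] by (auto simp: is_supremum_def)
  qed (use emb in blast)
  have "x \<in> g ` M" if x: "x \<in> P" for x
  proof -
    obtain K where K: "K \<in> ?QM" "\<phi> K = ?uP x"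
      using QP[OF x] bij by (metis bij_betw_imp_surj_on imageE)
    have KM: "K \<subseteq> M" using upM[OF K(1)] by (simp add: upper_set_def)
    \<comment> \<open>\<open>\<phi> K\<close> is the least compact upper set containing \<open>g ` K\<close>, so \<open>x\<close> lies in the upper set
      generated by \<open>g ` K\<close> once that set is known to be compact.\<close>
    have "compactin (scott_topology P r) (g ` K)"
      using K(1) cont by (auto simp: compact_upper_sets_def intro: image_compactin)
    then have "up_closure P r (g ` K) \<in> ?QP" by (rule up_closure_in_compact_upper_sets[OF poP])
    then obtain L where L: "L \<in> ?QM" "\<phi> L = up_closure P r (g ` K)"
      using bij by (metis bij_betw_imp_surj_on imageE)
    have "g ` K \<subseteq> \<phi> L" using subset_up_closure[OF poP, of "g ` K"] KM gP L(2) by auto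
    then have "K \<subseteq> L" using mem[OF _ L(1)] KM by blast
    then have "?uP x \<subseteq> up_closure P r (g ` K)" using iso[OF K(1) L(1)] K(2) L(2) by simp
    then have "x \<in> up_closure P r (g ` K)" using subset_up_closure[OF poP, of "{x}"] x by blast
    then obtain y where y: "y \<in> K" "(g y, x) \<in> r" by (auto simp: up_closure_def)
    have "(x, g y) \<in> r" using mem[OF _ K(1), of y] y KM K(2) by (auto simp: mem_principal)
    then have "x = g y" using y(2) partial_order_onD(3)[OF poP] by (auto dest: antisymD)
    then show ?thesis using y(1) KM by blast
  qed
  moreover have "inj_on g M"
  proof (rule inj_onI)
    fix x y assume xy: "x \<in> M" "y \<in> M" "g x = g y"
    have "(g x, g x) \<in> r" using partial_order_onD(1)[OF poP] gP[OF xy(1)] by (auto simp: refl_on_def)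
    then have "(x, y) \<in> s" "(y, x) \<in> s" using emb xy by auto
    then show "x = y" using partial_order_onD(3)[OF poM] by (auto dest: antisymD)
  qed
  ultimately have "bij_betw g M P" using gP by (auto simp: bij_betw_def)
  then show ?thesis using emb by (auto simp: order_isomorphic_def)
qed

theorem corollary3p20:
  fixes P :: "'a set" and r :: "'a rel"
  assumes "partial_order_on P r"
    and "weakly_well_filtered (scott_topology P r)"
    and "co_sober (scott_topology P r)"
  shows "Q_sigma_unique TYPE('b) P r"
  unfolding Q_sigma_unique_def
proof (intro allI impI)
  fix M :: "'b set" and s
  assume M: "partial_order_on M s"
    and Q: "order_isomorphic
           (compact_upper_sets P r) (rev_incl (compact_upper_sets P r))
           (compact_upper_sets M s) (rev_incl (compact_upper_sets M s))"
  from order_isomorphic_sym[OF Q] obtain \<phi> where "bij_betw \<phi> (compact_upper_sets M s) (compact_upper_sets P r)"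
    and "\<forall>A\<in>compact_upper_sets M s. \<forall>B\<in>compact_upper_sets M s. A \<subseteq> B \<longleftrightarrow> \<phi> A \<subseteq> \<phi> B"
    unfolding order_isomorphic_rev_incl_iff by blast
  then have "order_isomorphic M s P r"
    by (intro order_isomorphic_of_co_sober[OF M assms(1,3)]) auto
  then show "order_isomorphic P r M s" by (rule order_isomorphic_sym)
qed

end
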